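(* Let $n,d,q$ be integers with $1\le d\le n$ and $q\ge n-d+2$. Then the chromatic number of the Hamming graph $H_q(n,d)$ is $$\chi(H_q(n,d))=q^{n-d+1}.$$
   Context: The Hamming graph $H_q(n,d)$ has as vertices all $q$-ary sequences of length $n$ (elements of $\Sigma^n$, $\Sigma=\{0,1,\dots,q-1\}$), and two vertices are adjacent iff their Hamming distance (the number of positions in which they differ) is at least $d$. *)

theory Defs
  imports "Graph_Theory.Pair_Digraph"
begin

text \<open>Meaningful only for lists of equal length.\<close>

definition hamming_dist :: "'a list \<Rightarrow> 'a list \<Rightarrow> nat" where
  "hamming_dist x y = card {i. i < length x \<and> x ! i \<noteq> y ! i}"

definition words :: "nat \<Rightarrow> nat \<Rightarrow> nat list set" where
  "words q n = {x. length x = n \<and> set x \<subseteq> {0..<q}}"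

text \<open>Undirected graphs are symmetric digraphs here, so each edge is the two arcs joining
  its ends.\<close>

definition hamming_graph :: "nat \<Rightarrow> nat \<Rightarrow> nat \<Rightarrow> nat list pair_pre_digraph" where
  "hamming_graph q n d =
     \<lparr>pverts = words q n,
      parcs = {(x, y). x \<in> words q n \<and> y \<in> words q n \<and> d \<le> hamming_dist x y}\<rparr>"

definition proper_colouring :: "('a, 'b) pre_digraph \<Rightarrow> nat \<Rightarrow> ('a \<Rightarrow> nat) \<Rightarrow> bool" where
  "proper_colouring G k c \<longleftrightarrow>
     c ` verts G \<subseteq> {0..<k} \<and> (\<forall>u v. u \<rightarrow>\<^bsub>G\<^esub> v \<longrightarrow> c u \<noteq> c v)"

definition chromatic_number :: "('a, 'b) pre_digraph \<Rightarrow> nat" where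
  "chromatic_number G = (LEAST k. \<exists>c. proper_colouring G k c)"

text \<open>\<open>LEAST\<close> picks an arbitrary number when no \<open>k\<close> qualifies; finite loopfree digraphs always
  have some proper colouring.\<close>

lemma (in digraph) chromatic_number_attained:
  "\<exists>c. proper_colouring G (chromatic_number G) c"
proof -
  obtain c where c: "bij_betw c (verts G) {0..<card (verts G)}"
    using ex_bij_betw_finite_nat[OF finite_verts] by blast
  have "c u \<noteq> c v" if "u \<rightarrow> v" for u v
  proof -
    have "u \<in> verts G" "v \<in> verts G" using that by auto
    moreover have "u \<noteq> v" using that adj_not_same by blast
    ultimately show ?thesis using c by (auto simp: bij_betw_def inj_on_def)
  qed
  then have "proper_colouring G (card (verts G)) c"
    using c by (auto simp: proper_colouring_def bij_betw_def)
  then show ?thesis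
    unfolding chromatic_number_def by (intro LeastI[of "\<lambda>k. \<exists>c. proper_colouring G k c"]) blast
qed

lemma finite_words: "finite (words q n)"
  using finite_lists_length_eq[of "{0..<q}" n] by (simp add: words_def conj_commute)

lemma hamming_dist_commute:
  "length x = length y \<Longrightarrow> hamming_dist x y = hamming_dist y x"
  unfolding hamming_dist_def by metis

lemma pair_graph_hamming_graph:
  assumes "1 \<le> d"
  shows "pair_graph (hamming_graph q n d)"
proof
  have "parcs (hamming_graph q n d) \<subseteq> words q n \<times> words q n"
    by (auto simp: hamming_graph_def)
  then show "finite (parcs (hamming_graph q n d))"
    by (rule finite_subset) (simp add: finite_words)
  show "symmetric (with_proj (hamming_graph q n d))"
    by (auto simp: symmetric_conv hamming_graph_def words_def hamming_dist_commute)
qed (use assms in \<open>auto simp: hamming_graph_def finite_words hamming_dist_def\<close>)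

end

theory Submission
  imports Defs "HOL-Library.FuncSet"
begin

text \<open>Put \<open>t = n - d + 1\<close>. Colouring a word by its first \<open>t\<close> letters is proper. Conversely a
  colour class \<open>C\<close> is a \<open>t\<close>-intersecting family, and \<open>card C \<le> q ^ (n - t)\<close> follows by a Delsarte
  (Lovasz theta) argument. Let \<open>\<beta> j\<close> be the number of codewords with a given support of size \<open>j\<close>
  in an \<open>[n, n - t, t + 1]\<close> MDS code; the formula for \<open>\<beta>\<close> makes sense even if there is no such
  code, and \<open>\<beta> \<ge> 0\<close> as soon as \<open>q \<ge> t + 1\<close>. The kernel
  \<open>f x y = (\<Sum>T. \<beta> (card T) * (\<Prod>i\<in>T. (q [x\<^sub>i = y\<^sub>i] - 1) / (q - 1)))\<close> is then a nonnegative
  combination of positive semidefinite ones, vanishes if \<open>x \<noteq> y\<close> agree in at least \<open>t\<close> places, and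
  is \<open>q ^ (n - t)\<close> on the diagonal. Summing over \<open>C \<times> C\<close> and keeping only \<open>T = {}\<close> on the left
  gives \<open>(card C)\<^sup>2 \<le> card C * q ^ (n - t)\<close>.\<close>

section \<open>Forward differences\<close>

definition fdiff :: "(nat \<Rightarrow> real) \<Rightarrow> nat \<Rightarrow> real" where
  "fdiff f u = f (Suc u) - f u"

lemma fdiff_pow_Suc: "(fdiff ^^ Suc m) f u = (fdiff ^^ m) f (Suc u) - (fdiff ^^ m) f u"
  by (simp add: fdiff_def[of "(fdiff ^^ m) f"])

lemma fdiff_pow_linear:
  "(fdiff ^^ m) (\<lambda>u. a * f u + b * g u) = (\<lambda>u. a * (fdiff ^^ m) f u + b * (fdiff ^^ m) g u)"
  by (induction m) (auto simp: fdiff_def algebra_simps)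

text \<open>Pascal's rule with signs. At \<open>u = 0\<close> this supplies the inhomogeneous term
  of the recursion for the weights.\<close>

lemma fdiff_pow_delta:
  "(fdiff ^^ m) (\<lambda>v. if v = s then 1 else 0) u =
     (if u \<le> s then (-1) ^ (m + s - u) * real (m choose (s - u)) else 0)"
proof (induction m arbitrary: u)
  case 0
  then show ?case by auto
next
  case (Suc m)
  show ?case
  proof (cases "u < s")
    case True
    then obtain k where k: "s = u + Suc k"
      by (metis add_Suc_right less_imp_Suc_add)
    show ?thesis unfolding fdiff_pow_Suc Suc by (simp add: k algebra_simps)
  next
    case False
    then show ?thesis unfolding fdiff_pow_Suc Suc by auto
  qed
qed

text \<open>Each pair \<open>U\<close>, \<open>insert x U\<close> of subsets of
  \<open>insert x T\<close> contributes a value of \<open>fdiff h\<close>, so every element uses up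
  one difference. This turns \<open>mds_weight\<close> into an inclusion-exclusion sum.\<close>

lemma sum_Pow_fdiff:
  assumes "finite T"
  shows "(\<Sum>U\<in>Pow T. (-1) ^ card (T - U) * h (card U)) = (fdiff ^^ card T) h 0"
  using assms
proof (induction T arbitrary: h rule: finite_induct)
  case empty
  then show ?case by simp
next
  case (insert x T)
  have disj: "Pow T \<inter> insert x ` Pow T = {}" using insert by auto
  have inj: "inj_on (insert x) (Pow T)"
    using insert by (intro inj_onI) (metis PowD insert_ident subsetD)
  have 1: "(-1) ^ card (insert x T - U) * h (card U) = - ((-1) ^ card (T - U) * h (card U))"
    and 2: "(-1) ^ card (insert x T - insert x U) * h (card (insert x U))
      = (-1) ^ card (T - U) * h (Suc (card U))"
    if "U \<in> Pow T" for U
  proof -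
    have U: "finite U" "x \<notin> U" using that insert finite_subset by auto
    then have "insert x T - U = insert x (T - U)" "insert x T - insert x U = T - U"
      using insert that by auto
    then show "(-1) ^ card (insert x T - U) * h (card U) = - ((-1) ^ card (T - U) * h (card U))"
      and "(-1) ^ card (insert x T - insert x U) * h (card (insert x U))
      = (-1) ^ card (T - U) * h (Suc (card U))"
      using U insert by auto
  qed
  have "(\<Sum>U\<in>Pow (insert x T). (-1) ^ card (insert x T - U) * h (card U)) =
     (\<Sum>U\<in>Pow T. (-1) ^ card (insert x T - U) * h (card U)) +
     (\<Sum>U\<in>Pow T. (-1) ^ card (insert x T - insert x U) * h (card (insert x U)))"
    using insert.hyps disj inj by (simp add: Pow_insert sum.union_disjoint sum.reindex)
  also have "\<dots> = (\<Sum>U\<in>Pow T. - ((-1) ^ card (T - U) * h (card U))) +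
     (\<Sum>U\<in>Pow T. (-1) ^ card (T - U) * h (Suc (card U)))"
    using 1 2 by (intro arg_cong2[of _ _ _ _ "(+)"] sum.cong refl)
  also have "\<dots> = (\<Sum>U\<in>Pow T. (-1) ^ card (T - U) * fdiff h (card U))"
    by (simp add: fdiff_def algebra_simps flip: sum.distrib)
  also have "\<dots> = (fdiff ^^ card (insert x T)) h 0"
    using insert by (simp add: funpow_swap1 del: funpow.simps) (simp add: funpow_swap1)
  finally show ?case .
qed

section \<open>Weights of MDS codes\<close>

text \<open>Truncated subtraction is intended: an MDS code of dimension \<open>n - t\<close> has \<open>q ^ (u - t)\<close>
  codewords supported in a given \<open>u\<close>-set, hence only the zero word if \<open>u \<le> t\<close>, and differencing is
  inclusion-exclusion.\<close>

definition mds_weight :: "nat \<Rightarrow> nat \<Rightarrow> nat \<Rightarrow> real" where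
  "mds_weight q t j = (fdiff ^^ j) (\<lambda>u. real q ^ (u - t)) 0"

text \<open>From index 1 on, the weights follow, up to a constant factor, a first-order recursion
  with growth factor \<open>q - 1\<close>. Its negative binomial corrections are outweighed by the
  positive ones just before them, since \<open>t \<le> q - 1\<close>.\<close>

lemma mds_weight_nonneg:
  assumes "1 \<le> t" "t < q"
  shows "0 \<le> mds_weight q t j"
proof (cases j)
  case 0
  then show ?thesis by (simp add: mds_weight_def)
next
  case (Suc m)
  define p where "p = real q - 1"
  define s where "s = t - 1"
  have t: "t = Suc s" using assms by (simp add: s_def)
  have p: "p \<ge> real s + 1" using assms by (simp add: p_def t)
  define g where "g u = (if u \<ge> t then real q ^ (u - t) else 0)" for u
  define e where "e m = (fdiff ^^ m) g 0" for m
  \<comment> \<open>For \<open>u < t\<close> both truncated powers are 1 and the difference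
    vanishes; hence the cut-off in \<open>g\<close>. The zero term only fits the shape of
    \<open>fdiff_pow_linear\<close>.\<close>
  have "fdiff (\<lambda>u. real q ^ (u - t)) = (\<lambda>u. p * g u + 0 * g u)"
    by (auto simp: fdiff_def g_def p_def fun_eq_iff Suc_diff_le algebra_simps)
  then have weight: "mds_weight q t (Suc m) = p * e m" for m
    using fdiff_pow_linear[of m p g 0 g]
    by (simp add: mds_weight_def e_def funpow_swap1 del: funpow.simps) (simp add: funpow_swap1)
  \<comment> \<open>The delta is the jump of \<open>g\<close> from 0 at \<open>s\<close> to 1 at
    \<open>t\<close>.\<close>
  have g_step: "fdiff g = (\<lambda>u. p * g u + 1 * (if u = s then 1 else 0))"
  proof
    fix u
    consider "u < s" | "u = s" | k where "u = t + k"
      unfolding t using le_Suc_ex[of "Suc s" u] by fastforce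
    then show "fdiff g u = p * g u + 1 * (if u = s then 1 else 0)"
      by cases (auto simp: fdiff_def g_def p_def t algebra_simps)
  qed
  have rec: "e (Suc m) = p * e m + (-1) ^ (m + s) * real (m choose s)" for m
  proof -
    have "e (Suc m) = (fdiff ^^ m) (fdiff g) 0" by (simp add: e_def funpow_swap1)
    also have "\<dots> = p * e m + (-1) ^ (m + s) * real (m choose s)"
      unfolding g_step fdiff_pow_linear by (simp add: e_def fdiff_pow_delta)
    finally show ?thesis .
  qed
  have small: "e m = 0" if "m \<le> s" for m
    using that
  proof (induction m)
    case 0
    then show ?case by (simp add: e_def g_def t)
  next
    case (Suc m)
    then show ?case by (simp add: rec)
  qed
  \<comment> \<open>The ratio of the two binomials is \<open>(m + 1) / (m + 1 - s)\<close>, largest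
    at \<open>m = s\<close>, where it equals \<open>t\<close>; here \<open>t < q\<close>
    enters.\<close>
  have bin: "real (Suc m choose s) \<le> p * real (m choose s)" if ms: "m \<ge> s" for m
  proof -
    have "Suc m \<le> Suc s * (Suc m - s)"
    proof -
      obtain k where "m = s + k" using le_Suc_ex[OF ms] by auto
      then show ?thesis by (simp add: Suc_diff_le)
    qed
    moreover have "(Suc m choose s) * (Suc m - s) = Suc m * (m choose s)"
      using binomial_absorb_comp[of "Suc m" s] by (simp add: mult.commute)
    ultimately have "(Suc m choose s) * (Suc m - s) \<le> Suc s * (m choose s) * (Suc m - s)"
      by (metis mult.assoc mult.commute mult_le_mono1)
    then have "(Suc m choose s) \<le> Suc s * (m choose s)"
      using ms by (simp only: mult_le_cancel2)
    then have "real (Suc m choose s) \<le> (real s + 1) * real (m choose s)"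
      by (metis of_nat_Suc of_nat_le_iff of_nat_mult add.commute)
    also have "\<dots> \<le> p * real (m choose s)" using p by (intro mult_right_mono) auto
    finally show ?thesis .
  qed
  text \<open>The correction term in \<open>rec\<close> alternates in sign, so steps are taken in pairs.\<close>
  have even: "0 \<le> e (s + 2 * k)" for k
  proof (induction k)
    case 0
    then show ?case by (simp add: small)
  next
    case (Suc k)
    have "e (s + 2 * Suc k) = p * p * e (s + 2 * k)
        + (p * real ((s + 2 * k) choose s) - real (Suc (s + 2 * k) choose s))"
      by (simp add: rec algebra_simps del: binomial_Suc_Suc flip: mult_2)
    then show ?case using Suc bin[of "s + 2 * k"] by simp
  qed
  have odd: "0 \<le> e (Suc (s + 2 * k))" for k
    using even[of k] p by (simp add: rec flip: mult_2)
  have "0 \<le> e m"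
  proof (cases "m \<le> s")
    case False
    then obtain k where k: "m = s + k" using le_Suc_ex[of s m] by auto
    show ?thesis
      using even[of "k div 2"] odd[of "k div 2"] k
      by (cases "even k") (auto elim!: evenE oddE)
  qed (simp add: small)
  then show ?thesis using weight p Suc by simp
qed

lemma sum_Pow_Pow_swap:
  assumes "finite I"
  shows "(\<Sum>T\<in>Pow I. \<Sum>U\<in>Pow T. F T U) = (\<Sum>U\<in>Pow I. \<Sum>V\<in>Pow (I - U). F (U \<union> V) U)"
proof -
  have fin: "finite T" if "T \<subseteq> I" for T using assms that finite_subset by auto
  have "(\<Sum>T\<in>Pow I. \<Sum>U\<in>Pow T. F T U) = (\<Sum>(T,U)\<in>(SIGMA T:Pow I. Pow T). F T U)"
    by (intro sum.Sigma) (auto simp: assms fin)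
  also have "\<dots> = (\<Sum>(U,V)\<in>(SIGMA U:Pow I. Pow (I - U)). F (U \<union> V) U)"
    by (rule sum.reindex_bij_witness[of _ "\<lambda>(U,V). (U \<union> V, U)" "\<lambda>(T,U). (U, T - U)"])
      (auto simp: Un_absorb1)
  also have "\<dots> = (\<Sum>U\<in>Pow I. \<Sum>V\<in>Pow (I - U). F (U \<union> V) U)"
    by (intro sum.Sigma[symmetric]) (auto simp: assms)
  finally show ?thesis .
qed

text \<open>In the application \<open>A\<close> is the set of places where two words agree.
  Expanding the weights over \<open>U \<subseteq> T\<close> and summing over \<open>T - U\<close>
  first yields factors \<open>1 - \<phi> i\<close>, which kill every \<open>U\<close> not containing
  \<open>A\<close>. The remaining sum factorises into \<open>1 + (q - 1) * \<phi> i\<close>, which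
  is zero off \<open>A\<close>.\<close>

lemma sum_mds_weight_prod:
  fixes \<phi> :: "'a \<Rightarrow> real"
  assumes I: "finite I" "A \<subseteq> I" and t: "t \<le> card A" and "0 < q"
    and in_A: "\<And>i. i \<in> A \<Longrightarrow> \<phi> i = 1"
    and out_A: "\<And>i. i \<in> I - A \<Longrightarrow> 1 + (real q - 1) * \<phi> i = 0"
  shows "(\<Sum>T\<in>Pow I. mds_weight q t (card T) * prod \<phi> T)
    = (if A = I then real q ^ (card I - t) else 0)"
proof -
  have fin: "finite T" if "T \<subseteq> I" for T using I that finite_subset by auto
  have "(\<Sum>T\<in>Pow I. mds_weight q t (card T) * prod \<phi> T) =
    (\<Sum>T\<in>Pow I. \<Sum>U\<in>Pow T. (-1) ^ card (T - U) * real q ^ (card U - t) * prod \<phi> T)"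
    unfolding mds_weight_def
    by (intro sum.cong refl) (simp add: sum_Pow_fdiff[symmetric] fin sum_distrib_right)
  also have "\<dots> = (\<Sum>U\<in>Pow I. \<Sum>V\<in>Pow (I - U).
      (-1) ^ card (U \<union> V - U) * real q ^ (card U - t) * prod \<phi> (U \<union> V))"
    by (rule sum_Pow_Pow_swap[OF I(1)])
  also have "\<dots> = (\<Sum>U\<in>Pow I. real q ^ (card U - t) * prod \<phi> U * (\<Prod>i\<in>I - U. 1 - \<phi> i))"
  proof (intro sum.cong refl)
    fix U assume U: "U \<in> Pow I"
    have "(\<Sum>V\<in>Pow (I - U). (-1) ^ card (U \<union> V - U) * real q ^ (card U - t) * prod \<phi> (U \<union> V))
      = (\<Sum>V\<in>Pow (I - U). real q ^ (card U - t) * prod \<phi> U * ((\<Prod>i\<in>V. - \<phi> i) * (\<Prod>i\<in>I - U - V. 1)))"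
    proof (intro sum.cong refl)
      fix V assume V: "V \<in> Pow (I - U)"
      have "U \<union> V - U = V" using V by auto
      moreover have "prod \<phi> (U \<union> V) = prod \<phi> U * prod \<phi> V"
        using U V by (intro prod.union_disjoint fin) auto
      ultimately show "(-1) ^ card (U \<union> V - U) * real q ^ (card U - t) * prod \<phi> (U \<union> V)
        = real q ^ (card U - t) * prod \<phi> U * ((\<Prod>i\<in>V. - \<phi> i) * (\<Prod>i\<in>I - U - V. 1))"
        by (simp add: prod_uminus)
    qed
    also have "\<dots> = real q ^ (card U - t) * prod \<phi> U * (\<Prod>i\<in>I - U. - \<phi> i + 1)"
      using I by (subst prod_add) (auto simp: sum_distrib_left)
    finally show "(\<Sum>V\<in>Pow (I - U). (-1) ^ card (U \<union> V - U) * real q ^ (card U - t) * prod \<phi> (U \<union> V))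
      = real q ^ (card U - t) * prod \<phi> U * (\<Prod>i\<in>I - U. 1 - \<phi> i)" by simp
  qed
  text \<open>Only \<open>U \<supseteq> A\<close> contribute, and for these the truncated exponent is harmless.\<close>
  also have "\<dots> = (\<Sum>U\<in>Pow I. ((\<Prod>i\<in>U. real q * \<phi> i) * (\<Prod>i\<in>I - U. 1 - \<phi> i)) / real q ^ t)"
  proof (intro sum.cong refl)
    fix U assume U: "U \<in> Pow I"
    show "real q ^ (card U - t) * prod \<phi> U * (\<Prod>i\<in>I - U. 1 - \<phi> i)
      = ((\<Prod>i\<in>U. real q * \<phi> i) * (\<Prod>i\<in>I - U. 1 - \<phi> i)) / real q ^ t"
    proof (cases "A \<subseteq> U")
      case True
      then have "t \<le> card U" using t U by (meson PowD card_mono fin le_trans)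
      then show ?thesis
        using \<open>0 < q\<close> by (simp add: prod.distrib power_diff)
    next
      case False
      then obtain a where "a \<in> A" "a \<notin> U" by auto
      then have "(\<Prod>i\<in>I - U. 1 - \<phi> i) = 0"
        using I in_A by (intro prod_zero) auto
      then show ?thesis by simp
    qed
  qed
  also have "\<dots> = (\<Prod>i\<in>I. real q * \<phi> i + (1 - \<phi> i)) / real q ^ t"
    using I by (simp add: prod_add sum_divide_distrib)
  also have "\<dots> = (if A = I then real q ^ (card I - t) else 0)"
  proof (cases "A = I")
    case True
    then have "(\<Prod>i\<in>I. real q * \<phi> i + (1 - \<phi> i)) = real q ^ card I"
      using in_A by simp
    then show ?thesis using True t \<open>0 < q\<close> by (simp add: power_diff)
  next
    case False
    then obtain a where "a \<in> I - A" using I by auto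
    moreover have "real q * \<phi> a + (1 - \<phi> a) = 1 + (real q - 1) * \<phi> a"
      by (simp add: algebra_simps)
    ultimately have "(\<Prod>i\<in>I. real q * \<phi> i + (1 - \<phi> i)) = 0"
      using I out_A by (intro prod_zero) auto
    then show ?thesis using False by simp
  qed
  finally show ?thesis .
qed

section \<open>Intersecting families of words\<close>

text \<open>In matrix form \<open>(q I - J)^2 = q (q I - J)\<close> with \<open>J\<close> all ones:
  \<open>q I - J\<close> is \<open>q\<close> times an orthogonal projection.\<close>

lemma sum_delta_products:
  assumes "a < q" "b < q"
  shows "(\<Sum>c<q. (real q * of_bool (a = c) - 1) * (real q * of_bool (b = c) - 1))
    = real q * (real q * of_bool (a = b) - 1)"
proof -
  have "(\<Sum>c<q. (real q * of_bool (a = c) - 1) * (real q * of_bool (b = c) - 1))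
    = (\<Sum>c<q. (if c = a then real q * real q * of_bool (a = b) else 0)
        - (if c = a then real q else 0) - (if c = b then real q else 0) + 1)"
    by (intro sum.cong) (auto simp: algebra_simps)
  also have "\<dots> = real q * (real q * of_bool (a = b) - 1)"
    using assms by (simp add: sum.distrib sum_subtractf algebra_simps)
  finally show ?thesis .
qed

lemma agreement_kernel_psd:
  assumes "finite T" "0 < q" and C: "\<And>x i. x \<in> C \<Longrightarrow> i \<in> T \<Longrightarrow> x ! i < q"
  shows "0 \<le> (\<Sum>x\<in>C. \<Sum>y\<in>C. \<Prod>i\<in>T. real q * of_bool (x ! i = y ! i) - 1)"
proof -
  \<comment> \<open>\<open>P x\<close> is a vector indexed by the assignments \<open>c\<close> on
    \<open>T\<close>; up to the factor \<open>q ^ card T\<close> the kernel is the Gram matrix of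
    these vectors.\<close>
  define P where "P x c = (\<Prod>i\<in>T. real q * of_bool (x ! i = c i) - 1)" for x :: "nat list" and c
  let ?E = "T \<rightarrow>\<^sub>E {..<q}"
  have "real q ^ card T * (\<Sum>x\<in>C. \<Sum>y\<in>C. \<Prod>i\<in>T. real q * of_bool (x ! i = y ! i) - 1)
    = (\<Sum>x\<in>C. \<Sum>y\<in>C. \<Prod>i\<in>T. real q * (real q * of_bool (x ! i = y ! i) - 1))"
    by (simp add: prod.distrib sum_distrib_left)
  also have "\<dots> = (\<Sum>x\<in>C. \<Sum>y\<in>C. \<Sum>c\<in>?E. P x c * P y c)"
  proof (intro sum.cong refl)
    fix x y assume xy: "x \<in> C" "y \<in> C"
    have "(\<Prod>i\<in>T. real q * (real q * of_bool (x ! i = y ! i) - 1))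
      = (\<Prod>i\<in>T. \<Sum>c<q. (real q * of_bool (x ! i = c) - 1) * (real q * of_bool (y ! i = c) - 1))"
      using C xy by (intro prod.cong refl sum_delta_products[symmetric]) auto
    also have "\<dots> = (\<Sum>c\<in>?E. P x c * P y c)"
      using assms by (subst prod_sum_PiE) (auto simp: P_def prod.distrib)
    finally show "(\<Prod>i\<in>T. real q * (real q * of_bool (x ! i = y ! i) - 1)) = (\<Sum>c\<in>?E. P x c * P y c)" .
  qed
  also have "\<dots> = (\<Sum>c\<in>?E. \<Sum>x\<in>C. \<Sum>y\<in>C. P x c * P y c)"
    by (subst sum.swap[of _ C ?E, symmetric]) (intro sum.cong refl sum.swap)
  also have "\<dots> = (\<Sum>c\<in>?E. (\<Sum>x\<in>C. P x c)\<^sup>2)"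
    by (simp add: power2_eq_square sum_product)
  also have "\<dots> \<ge> 0" by (intro sum_nonneg) auto
  finally have "real q ^ card T * 0 \<le>
      real q ^ card T * (\<Sum>x\<in>C. \<Sum>y\<in>C. \<Prod>i\<in>T. real q * of_bool (x ! i = y ! i) - 1)"
    unfolding mult_zero_right .
  then show ?thesis by (rule mult_left_le_imp_le) (use \<open>0 < q\<close> in simp)
qed

lemma card_words: "card (words q n) = q ^ n"
  using card_lists_length_eq[of "{0..<q}" n] by (simp add: words_def conj_commute)

lemma nth_words_less: "x \<in> words q n \<Longrightarrow> i < n \<Longrightarrow> x ! i < q"
  using nth_mem[of i x] by (auto simp: words_def subset_iff)

theorem intersecting_words_card_le:
  assumes C: "C \<subseteq> words q n" and t: "1 \<le> t" "t \<le> n" "t < q"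
    and agree: "\<And>x y. x \<in> C \<Longrightarrow> y \<in> C \<Longrightarrow> t \<le> card {i. i < n \<and> x ! i = y ! i}"
  shows "card C \<le> q ^ (n - t)"
proof -
  define p where "p = real q - 1"
  have p: "p > 0" and q: "0 < q" using t by (auto simp: p_def)
  have finC: "finite C" using C finite_words finite_subset by blast
  define I where "I = {..<n}"
  \<comment> \<open>Scaled to be 1 at an agreement and \<open>-1 / (q - 1)\<close> at a
    disagreement, as \<open>sum_mds_weight_prod\<close> requires.\<close>
  define \<phi> where "\<phi> x y i = (real q * of_bool (x ! i = y ! i) - 1) / p" for x y :: "nat list" and i
  define S where "S T = (\<Sum>x\<in>C. \<Sum>y\<in>C. prod (\<phi> x y) T)" for T
  have S_nonneg: "0 \<le> S T" if "T \<subseteq> I" for T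
  proof -
    have "finite T" using that finite_subset by (auto simp: I_def)
    then have "0 \<le> (\<Sum>x\<in>C. \<Sum>y\<in>C. \<Prod>i\<in>T. real q * of_bool (x ! i = y ! i) - 1)"
      using that C q by (intro agreement_kernel_psd) (auto simp: I_def intro!: nth_words_less)
    moreover have "S T = (\<Sum>x\<in>C. \<Sum>y\<in>C. \<Prod>i\<in>T. real q * of_bool (x ! i = y ! i) - 1) / p ^ card T"
      by (simp add: S_def \<phi>_def prod_dividef sum_divide_distrib)
    ultimately show ?thesis using p by simp
  qed
  have kernel: "(\<Sum>T\<in>Pow I. mds_weight q t (card T) * prod (\<phi> x y) T)
      = (if y = x then real q ^ (n - t) else 0)" if "x \<in> C" "y \<in> C" for x y
  proof -
    let ?A = "{i. i < n \<and> x ! i = y ! i}"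
    have "(\<Sum>T\<in>Pow I. mds_weight q t (card T) * prod (\<phi> x y) T)
      = (if ?A = I then real q ^ (card I - t) else 0)"
      using agree that p q
      by (intro sum_mds_weight_prod) (auto simp: I_def \<phi>_def p_def)
    moreover have "?A = I \<longleftrightarrow> y = x"
    proof (rule iffI)
      assume "?A = I"
      then have "i \<in> ?A" if "i < n" for i using that by (simp add: I_def)
      then have "y ! i = x ! i" if "i < n" for i using that by (metis (lifting) mem_Collect_eq)
      moreover have "length y = n" "length x = n" using that C by (auto simp: words_def)
      ultimately show "y = x" by (simp add: nth_equalityI)
    qed (auto simp: I_def)
    ultimately show ?thesis by (simp add: I_def)
  qed
  \<comment> \<open>Truncation makes \<open>real q ^ (0 - t)\<close> equal to 1, and empty products
    are 1, so this term counts all pairs.\<close>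
  have "real (card C) ^ 2 = mds_weight q t (card ({}::nat set)) * S {}"
    by (simp add: mds_weight_def S_def power2_eq_square)
  also have "\<dots> \<le> (\<Sum>T\<in>Pow I. mds_weight q t (card T) * S T)"
    using S_nonneg mds_weight_nonneg[of t q] t
    by (intro member_le_sum) (auto simp: I_def)
  also have "\<dots> = (\<Sum>T\<in>Pow I. \<Sum>x\<in>C. \<Sum>y\<in>C. mds_weight q t (card T) * prod (\<phi> x y) T)"
    by (simp add: S_def sum_distrib_left)
  also have "\<dots> = (\<Sum>x\<in>C. \<Sum>y\<in>C. \<Sum>T\<in>Pow I. mds_weight q t (card T) * prod (\<phi> x y) T)"
    by (subst sum.swap) (intro sum.cong refl sum.swap)
  also have "\<dots> = (\<Sum>x\<in>C. \<Sum>y\<in>C. if y = x then real q ^ (n - t) else 0)"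
    by (intro sum.cong refl kernel)
  also have "\<dots> = real (card C) * real (q ^ (n - t))"
    using finC by simp
  finally have "real (card C) * real (card C) \<le> real (card C) * real (q ^ (n - t))"
    by (simp add: power2_eq_square)
  then show ?thesis
    by (cases "card C = 0") (auto simp flip: of_nat_power)
qed

section \<open>The chromatic number\<close>

lemma hamming_dist_agree:
  assumes "length x = n"
  shows "hamming_dist x y + card {i. i < n \<and> x ! i = y ! i} = n"
proof -
  have "hamming_dist x y + card {i. i < n \<and> x ! i = y ! i}
    = card ({i. i < n \<and> x ! i \<noteq> y ! i} \<union> {i. i < n \<and> x ! i = y ! i})"
    unfolding hamming_dist_def assms by (intro card_Un_disjoint[symmetric]) auto
  also have "{i. i < n \<and> x ! i \<noteq> y ! i} \<union> {i. i < n \<and> x ! i = y ! i} = {..<n}" by auto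
  finally show ?thesis by simp
qed

lemma hamming_graph_arc:
  "u \<rightarrow>\<^bsub>with_proj (hamming_graph q n d)\<^esub> v \<longleftrightarrow>
     u \<in> words q n \<and> v \<in> words q n \<and> d \<le> hamming_dist u v"
  by (auto simp: hamming_graph_def arcs_ends_conv)

theorem lemma18:
  fixes n d q :: nat
  assumes "1 \<le> d" and "d \<le> n" and "n - d + 2 \<le> q"
  shows "chromatic_number (with_proj (hamming_graph q n d)) = q ^ (n - d + 1)"
proof -
  define t where "t = n - d + 1"
  have t: "1 \<le> t" "t \<le> n" "t < q" using assms by (auto simp: t_def)
  let ?G = "with_proj (hamming_graph q n d)"
  have verts: "verts ?G = words q n" by (simp add: hamming_graph_def)
  \<comment> \<open>Colours are numbers, so the prefixes of length \<open>t\<close> get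
    numbered.\<close>
  obtain b where b: "bij_betw b (words q t) {0..<q ^ t}"
    using ex_bij_betw_finite_nat[OF finite_words, of q t] by (auto simp: card_words)
  have take_words: "take t x \<in> words q t" if "x \<in> words q n" for x
    using that t set_take_subset[of t x] by (auto simp: words_def)
  have "proper_colouring ?G (q ^ t) (b \<circ> take t)"
    unfolding proper_colouring_def verts
  proof (intro conjI allI impI)
    show "(b \<circ> take t) ` words q n \<subseteq> {0..<q ^ t}"
      using b take_words by (auto simp: bij_betw_def)
    fix u v assume "u \<rightarrow>\<^bsub>?G\<^esub> v"
    then have uv: "u \<in> words q n" "v \<in> words q n" "d \<le> hamming_dist u v"
      unfolding hamming_graph_arc by auto
    show "(b \<circ> take t) u \<noteq> (b \<circ> take t) v"
    proof
      assume "(b \<circ> take t) u = (b \<circ> take t) v"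
      then have eq: "take t u = take t v"
        using uv by (intro inj_onD[OF bij_betw_imp_inj_on[OF b]] take_words) simp_all
      \<comment> \<open>A common prefix forces \<open>t\<close> agreements, hence distance at most
        \<open>n - t = d - 1\<close>.\<close>
      have "card {..<t} \<le> card {i. i < n \<and> u ! i = v ! i}"
        using t eq by (intro card_mono) (auto, metis nth_take)
      moreover have "d + card {i. i < n \<and> u ! i = v ! i} \<le> n"
        using hamming_dist_agree[of u n v] uv by (auto simp: words_def)
      ultimately show False using assms by (simp add: t_def)
    qed
  qed
  moreover have "q ^ t \<le> k" if "proper_colouring ?G k c" for k c
  proof -
    have proper: "c u \<noteq> c v"
      if "u \<in> words q n" "v \<in> words q n" "d \<le> hamming_dist u v" for u v
      using \<open>proper_colouring ?G k c\<close> that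
      unfolding proper_colouring_def hamming_graph_arc by blast
    define K where "K j = {x \<in> words q n. c x = j}" for j
    \<comment> \<open>Words of one colour are not adjacent: they differ in fewer than
      \<open>d\<close> places, so they agree in at least \<open>n - d + 1 = t\<close>.\<close>
    have "card (K j) \<le> q ^ (n - t)" for j
    proof (rule intersecting_words_card_le)
      fix x y assume xy: "x \<in> K j" "y \<in> K j"
      then have "hamming_dist x y < d"
        using proper[of x y] by (force simp: K_def)
      moreover have "hamming_dist x y + card {i. i < n \<and> x ! i = y ! i} = n"
        using xy by (intro hamming_dist_agree) (auto simp: K_def words_def)
      ultimately show "t \<le> card {i. i < n \<and> x ! i = y ! i}"
        using assms by (simp add: t_def)
    qed (use t in \<open>auto simp: K_def\<close>)
    moreover have "words q n = (\<Union>j<k. K j)"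
      using that unfolding proper_colouring_def verts K_def by auto
    ultimately have "card (words q n) \<le> k * q ^ (n - t)"
      using card_UN_le[of "{..<k}" K] sum_bounded_above[of "{..<k}" "card \<circ> K" "q ^ (n - t)"]
      by simp
    \<comment> \<open>The \<open>k\<close> classes cover all \<open>q ^ n\<close> words; the
      positive factor \<open>q ^ (n - t)\<close> then cancels.\<close>
    then have "q ^ t * q ^ (n - t) \<le> k * q ^ (n - t)"
      by (metis card_words le_add_diff_inverse power_add t(2))
    then show ?thesis using t by simp
  qed
  ultimately show ?thesis
    unfolding chromatic_number_def t_def[symmetric] by (intro Least_equality) blast+
qed

end
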